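(* Let $0<\alpha\le 1$ and let $m,n$ be natural numbers. If $S$ is a solution on $(0,\infty)$ of the conformable Laguerre differential equation of order $m+n$, $$x^\alpha D^\alpha D^\alpha S+(\alpha-x^\alpha)D^\alpha S+(n+m)\alpha\, S=0,$$ then $y=D^{m\alpha}S$ is a solution on $(0,\infty)$ of the conformable associated Laguerre differential equation $$x^\alpha D^\alpha D^\alpha y+(m\alpha+\alpha-x^\alpha)D^\alpha y+n\alpha\, y=0.$$
   Context: For $0<\alpha\le 1$, the conformable derivative of order $\alpha$ of a function $f$ at $x>0$ is $D^\alpha f(x)=\lim_{\epsilon\to 0}\frac{f(x+\epsilon x^{1-\alpha})-f(x)}{\epsilon}$. $D^{m\alpha}$ denotes the $m$-fold composition $D^\alpha\circ\cdots\circ D^\alpha$ (with $D^0$ the identity), and $D^\alpha D^\alpha$ is $D^\alpha$ applied twice in succession. A solution of such an equation on $(0,\infty)$ is a real-valued function to which $D^\alpha$ can be applied twice at every $x>0$ and which satisfies the equation at every $x>0$. *)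

theory Defs
  imports Complex_Main
begin

definition has_conf_deriv :: "real \<Rightarrow> (real \<Rightarrow> real) \<Rightarrow> real \<Rightarrow> real \<Rightarrow> bool" where
  "has_conf_deriv \<alpha> f L x \<longleftrightarrow>
     ((\<lambda>\<epsilon>. (f (x + \<epsilon> * x powr (1 - \<alpha>)) - f x) / \<epsilon>) \<longlongrightarrow> L) (at 0)"

definition conf_differentiable :: "real \<Rightarrow> (real \<Rightarrow> real) \<Rightarrow> real \<Rightarrow> bool" where
  "conf_differentiable \<alpha> f x \<longleftrightarrow> (\<exists>L. has_conf_deriv \<alpha> f L x)"

text \<open>The value is meaningful only where \<^term>\<open>conf_differentiable \<alpha> f x\<close> holds and \<open>x > 0\<close>.
  For \<open>x > 0\<close> it depends only on the values of \<open>f\<close> near \<open>x\<close>, so arbitrary values on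
  \<open>x \<le> 0\<close> never influence iterated derivatives at positive points.\<close>

definition conf_deriv :: "real \<Rightarrow> (real \<Rightarrow> real) \<Rightarrow> real \<Rightarrow> real" where
  "conf_deriv \<alpha> f x = Lim (at 0) (\<lambda>\<epsilon>. (f (x + \<epsilon> * x powr (1 - \<alpha>)) - f x) / \<epsilon>)"

definition iter_conf_deriv :: "real \<Rightarrow> nat \<Rightarrow> (real \<Rightarrow> real) \<Rightarrow> (real \<Rightarrow> real)" where
  "iter_conf_deriv \<alpha> m = conf_deriv \<alpha> ^^ m"

definition iter_conf_differentiable :: "real \<Rightarrow> nat \<Rightarrow> (real \<Rightarrow> real) \<Rightarrow> bool" where
  "iter_conf_differentiable \<alpha> m f \<longleftrightarrow>
     (\<forall>k<m. \<forall>x>0. conf_differentiable \<alpha> (iter_conf_deriv \<alpha> k f) x)"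

definition conf_laguerre_solution :: "real \<Rightarrow> nat \<Rightarrow> (real \<Rightarrow> real) \<Rightarrow> bool" where
  "conf_laguerre_solution \<alpha> N S \<longleftrightarrow>
     iter_conf_differentiable \<alpha> 2 S \<and>
     (\<forall>x>0. x powr \<alpha> * conf_deriv \<alpha> (conf_deriv \<alpha> S) x
            + (\<alpha> - x powr \<alpha>) * conf_deriv \<alpha> S x
            + real N * \<alpha> * S x = 0)"

definition conf_assoc_laguerre_solution :: "real \<Rightarrow> nat \<Rightarrow> nat \<Rightarrow> (real \<Rightarrow> real) \<Rightarrow> bool" where
  "conf_assoc_laguerre_solution \<alpha> m n y \<longleftrightarrow>
     iter_conf_differentiable \<alpha> 2 y \<and>
     (\<forall>x>0. x powr \<alpha> * conf_deriv \<alpha> (conf_deriv \<alpha> y) x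
            + (real m * \<alpha> + \<alpha> - x powr \<alpha>) * conf_deriv \<alpha> y x
            + real n * \<alpha> * y x = 0)"

end

theory Submission
  imports Defs
begin

text \<open>At \<open>x > 0\<close> the conformable derivative is \<open>x\<^sup>1\<^sup>-\<^sup>\<alpha> d/dx\<close>, so it obeys the usual rules of
  differentiation and \<open>D\<^sup>\<alpha> x\<^sup>\<alpha> = \<alpha>\<close>. Hence applying \<open>D\<^sup>\<alpha>\<close> to
  \<open>x\<^sup>\<alpha> D\<^sup>\<alpha>D\<^sup>\<alpha>y + (b - x\<^sup>\<alpha>) D\<^sup>\<alpha>y + c y = 0\<close> yields an equation of the same shape for \<open>D\<^sup>\<alpha>y\<close>, with
  \<open>(b, c)\<close> replaced by \<open>(b + \<alpha>, c - \<alpha>)\<close>; that \<open>D\<^sup>\<alpha>D\<^sup>\<alpha>y\<close> can be differentiated at all is seen by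
  solving the equation for it. Starting from \<open>(\<alpha>, (n + m)\<alpha>)\<close>, \<open>m\<close> differentiations lead to
  \<open>(m\<alpha> + \<alpha>, n\<alpha>)\<close>.\<close>

lemma has_conf_deriv_iff_has_real_derivative:
  assumes "x > 0"
  shows "has_conf_deriv \<alpha> f L x \<longleftrightarrow> (f has_real_derivative L * x powr (\<alpha> - 1)) (at x)"
proof -
  define s where "s = x powr (1 - \<alpha>)"
  have "s > 0" and inverse_s: "x powr (\<alpha> - 1) = 1 / s"
    using assms by (simp_all add: s_def flip: powr_minus_divide)
  have "has_conf_deriv \<alpha> f L x \<longleftrightarrow> ((\<lambda>\<epsilon>. f (x + \<epsilon> * s)) has_real_derivative L) (at 0)"
    by (simp add: has_conf_deriv_def DERIV_def s_def)
  also have "\<dots> \<longleftrightarrow> (f has_real_derivative L / s) (at x)"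
  proof
    assume "((\<lambda>\<epsilon>. f (x + \<epsilon> * s)) has_real_derivative L) (at 0)"
    moreover have "((\<lambda>t. (t - x) / s) has_real_derivative 1 / s) (at x)"
      using \<open>s > 0\<close> by (auto intro!: derivative_eq_intros)
    ultimately have "((\<lambda>t. f (x + (t - x) / s * s)) has_real_derivative L * (1 / s)) (at x)"
      by (intro DERIV_chain2 [where g = "\<lambda>t. (t - x) / s"]) simp_all
    then show "(f has_real_derivative L / s) (at x)"
      using \<open>s > 0\<close> by simp
  next
    assume "(f has_real_derivative L / s) (at x)"
    moreover have "((\<lambda>\<epsilon>. x + \<epsilon> * s) has_real_derivative s) (at 0)"
      by (auto intro!: derivative_eq_intros)
    ultimately have "((\<lambda>\<epsilon>. f (x + \<epsilon> * s)) has_real_derivative L / s * s) (at 0)"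
      by (intro DERIV_chain2 [where g = "\<lambda>\<epsilon>. x + \<epsilon> * s"]) simp_all
    then show "((\<lambda>\<epsilon>. f (x + \<epsilon> * s)) has_real_derivative L) (at 0)"
      using \<open>s > 0\<close> by simp
  qed
  finally show ?thesis
    by (simp add: inverse_s)
qed

lemma has_conf_deriv_imp_conf_deriv: "has_conf_deriv \<alpha> f L x \<Longrightarrow> conf_deriv \<alpha> f x = L"
  by (simp add: has_conf_deriv_def conf_deriv_def tendsto_Lim)

lemma conf_differentiable_iff_has_conf_deriv:
  "conf_differentiable \<alpha> f x \<longleftrightarrow> has_conf_deriv \<alpha> f (conf_deriv \<alpha> f x) x"
  using has_conf_deriv_imp_conf_deriv by (auto simp: conf_differentiable_def)

lemma has_conf_deriv_const: "has_conf_deriv \<alpha> (\<lambda>_. k) 0 x"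
  by (simp add: has_conf_deriv_def)

lemma has_conf_deriv_powr_self:
  assumes "x > 0"
  shows "has_conf_deriv \<alpha> (\<lambda>t. t powr \<alpha>) \<alpha> x"
  using assms by (simp add: has_conf_deriv_iff_has_real_derivative has_real_derivative_powr)

lemma has_conf_deriv_diff:
  assumes "has_conf_deriv \<alpha> f A x" "has_conf_deriv \<alpha> g B x"
  shows "has_conf_deriv \<alpha> (\<lambda>t. f t - g t) (A - B) x"
  using tendsto_diff [OF assms [unfolded has_conf_deriv_def]]
  by (simp add: has_conf_deriv_def algebra_simps flip: diff_divide_distrib)

lemma has_conf_deriv_mult:
  assumes "x > 0" "has_conf_deriv \<alpha> f A x" "has_conf_deriv \<alpha> g B x"
  shows "has_conf_deriv \<alpha> (\<lambda>t. f t * g t) (A * g x + f x * B) x"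
  using assms
  by (auto simp: has_conf_deriv_iff_has_real_derivative algebra_simps
      intro!: derivative_eq_intros)

lemma has_conf_deriv_divide:
  assumes "x > 0" "has_conf_deriv \<alpha> f A x" "has_conf_deriv \<alpha> g B x" "g x \<noteq> 0"
  shows "has_conf_deriv \<alpha> (\<lambda>t. f t / g t) ((A * g x - f x * B) / (g x * g x)) x"
  using assms
  by (auto simp: has_conf_deriv_iff_has_real_derivative field_simps
      intro!: derivative_eq_intros)

lemma has_conf_deriv_transform_within_open:
  assumes "x > 0" "has_conf_deriv \<alpha> f L x" "open U" "x \<in> U" "\<And>t. t \<in> U \<Longrightarrow> f t = g t"
  shows "has_conf_deriv \<alpha> g L x"
  using assms has_field_derivative_transform_within_open
  by (simp add: has_conf_deriv_iff_has_real_derivative) blast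

lemma iter_conf_differentiable_2_iff:
  "iter_conf_differentiable \<alpha> 2 f \<longleftrightarrow>
     (\<forall>x>0. conf_differentiable \<alpha> f x \<and> conf_differentiable \<alpha> (conf_deriv \<alpha> f) x)"
  by (auto simp: iter_conf_differentiable_def iter_conf_deriv_def numeral_2_eq_2 less_Suc_eq)

definition conf_laguerre_type_solution :: "real \<Rightarrow> real \<Rightarrow> real \<Rightarrow> (real \<Rightarrow> real) \<Rightarrow> bool" where
  "conf_laguerre_type_solution \<alpha> b c y \<longleftrightarrow>
     iter_conf_differentiable \<alpha> 2 y \<and>
     (\<forall>x>0. x powr \<alpha> * conf_deriv \<alpha> (conf_deriv \<alpha> y) x
            + (b - x powr \<alpha>) * conf_deriv \<alpha> y x + c * y x = 0)"

lemma conf_laguerre_solution_iff_type: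
  "conf_laguerre_solution \<alpha> N S \<longleftrightarrow> conf_laguerre_type_solution \<alpha> \<alpha> (real N * \<alpha>) S"
  by (simp add: conf_laguerre_solution_def conf_laguerre_type_solution_def)

lemma conf_assoc_laguerre_solution_iff_type:
  "conf_assoc_laguerre_solution \<alpha> m n y \<longleftrightarrow>
     conf_laguerre_type_solution \<alpha> (real m * \<alpha> + \<alpha>) (real n * \<alpha>) y"
  by (simp add: conf_assoc_laguerre_solution_def conf_laguerre_type_solution_def)

lemma laguerre_type_equation_imp_has_conf_deriv:
  assumes y_deriv: "has_conf_deriv \<alpha> y (z x) x"
    and z_deriv: "has_conf_deriv \<alpha> z (u x) x"
    and equation: "\<And>t. t > 0 \<Longrightarrow> t powr \<alpha> * u t + (b - t powr \<alpha>) * z t + c * y t = 0"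
    and "x > 0"
  shows "has_conf_deriv \<alpha> u
    (- ((b + \<alpha> - x powr \<alpha>) * u x + (c - \<alpha>) * z x) / x powr \<alpha>) x"
proof -
  define A where "A = x powr \<alpha>"
  have "A > 0" and powr_deriv: "has_conf_deriv \<alpha> (\<lambda>t. t powr \<alpha>) \<alpha> x"
    using \<open>x > 0\<close> by (simp_all add: A_def has_conf_deriv_powr_self)
  define p where "p t = (t powr \<alpha> - b) * z t - c * y t" for t
  have p_eq: "p t = t powr \<alpha> * u t" if "t > 0" for t
    using equation [OF that] by (simp add: p_def algebra_simps)
  have "has_conf_deriv \<alpha> p ((\<alpha> - 0) * z x + (A - b) * u x - (0 * y x + c * z x)) x"
    unfolding p_def A_def using \<open>x > 0\<close> y_deriv z_deriv powr_deriv
    by (intro has_conf_deriv_diff has_conf_deriv_mult has_conf_deriv_const)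
  then have p_deriv: "has_conf_deriv \<alpha> p (\<alpha> * z x + (A - b) * u x - c * z x) x"
    by simp
  have "has_conf_deriv \<alpha> (\<lambda>t. p t / t powr \<alpha>)
      (((\<alpha> * z x + (A - b) * u x - c * z x) * A - A * u x * \<alpha>) / (A * A)) x"
    using has_conf_deriv_divide [OF \<open>x > 0\<close> p_deriv powr_deriv] \<open>x > 0\<close>
    by (simp add: p_eq A_def)
  also have "((\<alpha> * z x + (A - b) * u x - c * z x) * A - A * u x * \<alpha>) / (A * A)
      = - ((b + \<alpha> - A) * u x + (c - \<alpha>) * z x) / A"
    using \<open>A > 0\<close> by (simp add: divide_simps) (simp add: algebra_simps)
  finally show ?thesis
    unfolding A_def
    by (rule has_conf_deriv_transform_within_open [where U = "{0<..}", rotated])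
      (use \<open>x > 0\<close> in \<open>simp_all add: p_eq\<close>)
qed

lemma conf_laguerre_type_solution_conf_deriv:
  assumes "conf_laguerre_type_solution \<alpha> b c y"
  shows "conf_laguerre_type_solution \<alpha> (b + \<alpha>) (c - \<alpha>) (conf_deriv \<alpha> y)"
proof -
  define z where "z = conf_deriv \<alpha> y"
  define u where "u = conf_deriv \<alpha> z"
  have y_deriv: "has_conf_deriv \<alpha> y (z x) x" and z_deriv: "has_conf_deriv \<alpha> z (u x) x"
    and equation: "x powr \<alpha> * u x + (b - x powr \<alpha>) * z x + c * y x = 0" if "x > 0" for x
    using assms that
    by (simp_all add: conf_laguerre_type_solution_def iter_conf_differentiable_2_iff
        conf_differentiable_iff_has_conf_deriv z_def u_def)
  have u_deriv: "has_conf_deriv \<alpha> u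
      (- ((b + \<alpha> - x powr \<alpha>) * u x + (c - \<alpha>) * z x) / x powr \<alpha>) x" if "x > 0" for x
    using y_deriv z_deriv equation that by (intro laguerre_type_equation_imp_has_conf_deriv)
  have "iter_conf_differentiable \<alpha> 2 z"
    using z_deriv u_deriv
    by (auto simp: iter_conf_differentiable_2_iff conf_differentiable_def simp flip: u_def)
  moreover have "x powr \<alpha> * conf_deriv \<alpha> u x + (b + \<alpha> - x powr \<alpha>) * u x + (c - \<alpha>) * z x = 0"
    if "x > 0" for x
    using that by (simp add: has_conf_deriv_imp_conf_deriv [OF u_deriv])
  ultimately show ?thesis
    by (simp add: conf_laguerre_type_solution_def flip: z_def u_def)
qed

lemma conf_laguerre_type_solution_iter_conf_deriv:
  assumes "conf_laguerre_type_solution \<alpha> b c y"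
  shows "conf_laguerre_type_solution \<alpha> (b + real k * \<alpha>) (c - real k * \<alpha>) (iter_conf_deriv \<alpha> k y)"
proof (induction k)
  case 0
  show ?case
    using assms by (simp add: iter_conf_deriv_def)
next
  case (Suc k)
  from conf_laguerre_type_solution_conf_deriv [OF this] show ?case
    by (simp add: iter_conf_deriv_def algebra_simps)
qed

lemma conf_laguerre_type_solution_imp_iter_conf_differentiable:
  assumes "conf_laguerre_type_solution \<alpha> b c y"
  shows "iter_conf_differentiable \<alpha> k y"
  using conf_laguerre_type_solution_iter_conf_deriv [OF assms]
  unfolding iter_conf_differentiable_def [of _ k]
  by (simp add: conf_laguerre_type_solution_def iter_conf_differentiable_2_iff)

theorem mainTheorem5:
  fixes \<alpha> :: real and m n :: nat and S :: "real \<Rightarrow> real"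
  assumes "0 < \<alpha>" and "\<alpha> \<le> 1"
    and "conf_laguerre_solution \<alpha> (n + m) S"
  shows "iter_conf_differentiable \<alpha> m S \<and>
         conf_assoc_laguerre_solution \<alpha> m n (iter_conf_deriv \<alpha> m S)"
proof
  have solution: "conf_laguerre_type_solution \<alpha> \<alpha> (real (n + m) * \<alpha>) S"
    using assms(3) by (simp only: conf_laguerre_solution_iff_type)
  then show "iter_conf_differentiable \<alpha> m S"
    by (rule conf_laguerre_type_solution_imp_iter_conf_differentiable)
  show "conf_assoc_laguerre_solution \<alpha> m n (iter_conf_deriv \<alpha> m S)"
    using conf_laguerre_type_solution_iter_conf_deriv [OF solution, of m]
    by (simp add: conf_assoc_laguerre_solution_iff_type algebra_simps)
qed

end
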